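(* Let $G$ be a matrix weighted connected graph of order $n$ in which each weight is a positive definite matrix of order $k$, and let $L=L(G)$ and $R=R(G)$. Then $$\|L\boxtimes R\|=-2(n-1)I_k.$$
   Context: A matrix weighted graph is a finite, simple, undirected, connected graph in which each edge $ij$ is assigned a weight $W_{ij}=W_{ji}$ that is a (real symmetric) positive definite matrix of a given order $k$. For a matrix weighted graph $G$ with vertices $1,\dots,n$, the Laplacian $L=L(G)$ is the $nk\times nk$ block matrix with $k\times k$ blocks $L_{ii}=\sum_{j\sim i}W_{ij}^{-1}$, $L_{ij}=-W_{ij}^{-1}$ if $i\neq j$ and $i\sim j$, and $L_{ij}=0$ if $i\ne j$ and $i\nsim j$. A $(1)$-inverse of a matrix $M$ is a matrix $C$ with $MCM=M$. The resistance matrix $R=R(G)$ is the $nk\times nk$ block matrix with blocks $R_{ij}=L^{(1)}_{ii}+L^{(1)}_{jj}-L^{(1)}_{ij}-L^{(1)}_{ji}$, where $L^{(1)}$ is any $(1)$-inverse of $L$ (the result does not depend on the choice). For block matrices $M,N$ with the same block partition, $M\boxtimes N$ is the block matrix whose $ij$-th block is the matrix product $M_{ij}N_{ij}$. For a block matrix $M$ with all blocks of the same order, $\|M\|=\sum_{i,j}M_{ij}$ is the sum of all blocks of $M$ (a $k\times k$ matrix, not a norm). $I_k$ is the identity matrix of order $k$. *)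

theory Defs
  imports "HOL-Analysis.Analysis"
begin

definition pos_def :: "real^'k^'k \<Rightarrow> bool" where
  "pos_def A \<longleftrightarrow> transpose A = A \<and> (\<forall>x. x \<noteq> 0 \<longrightarrow> x \<bullet> (A *v x) > 0)"

text \<open>
  The vertex set is the finite type \<open>'n\<close> and \<open>E\<close> is its adjacency relation.
  The values of \<open>W\<close> on non-adjacent pairs are irrelevant.
\<close>

definition matrix_weighted_graph ::
  "('n::finite \<Rightarrow> 'n \<Rightarrow> bool) \<Rightarrow> ('n \<Rightarrow> 'n \<Rightarrow> real^'k^'k) \<Rightarrow> bool" where
  "matrix_weighted_graph E W \<longleftrightarrow>
     symp E \<and> irreflp E \<and> (\<forall>i j. E\<^sup>*\<^sup>* i j) \<and>
     (\<forall>i j. E i j \<longrightarrow> W i j = W j i \<and> pos_def (W i j))"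

text \<open>
  Rows and columns of a block matrix are indexed by pairs \<open>(i, a)\<close>, where \<open>i\<close> is the
  block index and \<open>a\<close> the index within the block.
\<close>

type_synonym ('n, 'k) block_matrix = "real^('n \<times> 'k)^('n \<times> 'k)"

definition block :: "('n::finite, 'k::finite) block_matrix \<Rightarrow> 'n \<Rightarrow> 'n \<Rightarrow> real^'k^'k" where
  "block M i j = (\<chi> a b. M $ (i, a) $ (j, b))"

definition of_blocks :: "('n \<Rightarrow> 'n \<Rightarrow> real^'k^'k) \<Rightarrow> ('n::finite, 'k::finite) block_matrix" where
  "of_blocks f = (\<chi> p q. f (fst p) (fst q) $ snd p $ snd q)"

lemma block_of_blocks [simp]: "block (of_blocks f) i j = f i j"
  by (simp add: block_def of_blocks_def vec_eq_iff)

lemma of_blocks_block [simp]: "of_blocks (block M) = M"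
  by (simp add: block_def of_blocks_def vec_eq_iff)

definition boxtimes ::
  "('n::finite, 'k::finite) block_matrix \<Rightarrow> ('n, 'k) block_matrix \<Rightarrow> ('n, 'k) block_matrix"
  (infixl \<open>\<box>\<times>\<close> 70) where
  "M \<box>\<times> N = of_blocks (\<lambda>i j. block M i j ** block N i j)"

definition block_sum :: "('n::finite, 'k::finite) block_matrix \<Rightarrow> real^'k^'k" where
  "block_sum M = (\<Sum>i\<in>UNIV. \<Sum>j\<in>UNIV. block M i j)"

definition laplacian ::
  "('n \<Rightarrow> 'n \<Rightarrow> bool) \<Rightarrow> ('n \<Rightarrow> 'n \<Rightarrow> real^'k^'k) \<Rightarrow> ('n::finite, 'k::finite) block_matrix" where
  "laplacian E W = of_blocks (\<lambda>i j.
     if i = j then (\<Sum>l | E i l. matrix_inv (W i l))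
     else if E i j then - matrix_inv (W i j)
     else 0)"

definition one_inverse :: "real^'m^'m \<Rightarrow> real^'m^'m \<Rightarrow> bool" where
  "one_inverse M C \<longleftrightarrow> M ** C ** M = M"

lemma one_inverse_exists: "\<exists>C. one_inverse M C"
proof -
  obtain g where g: "linear g" "\<forall>v\<in>range ((*v) M). M *v (g v) = v"
    using real_vector.linear_exists_right_inverse_on[OF matrix_vector_mul_linear, of UNIV M] by auto
  have "M *v (matrix g *v (M *v x)) = M *v x" for x
    using g by (simp add: matrix_works)
  then have "M ** matrix g ** M = M"
    by (simp add: matrix_eq matrix_vector_mul_assoc[symmetric])
  then show ?thesis
    unfolding one_inverse_def by blast
qed

text \<open>
  The resistance matrix does not depend on the choice of the (1)-inverse of the Laplacian,
  so it is introduced as a predicate: \<open>R\<close> is the matrix obtained from some (1)-inverse.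
\<close>

definition resistance_matrix ::
  "('n \<Rightarrow> 'n \<Rightarrow> bool) \<Rightarrow> ('n \<Rightarrow> 'n \<Rightarrow> real^'k^'k) \<Rightarrow> ('n::finite, 'k::finite) block_matrix \<Rightarrow> bool" where
  "resistance_matrix E W R \<longleftrightarrow>
     (\<exists>C. one_inverse (laplacian E W) C \<and>
          R = of_blocks (\<lambda>i j. block C i i + block C j j - block C i j - block C j i))"

lemma resistance_matrix_exists: "\<exists>R. resistance_matrix E W R"
  unfolding resistance_matrix_def using one_inverse_exists by blast

end

theory Submission
  imports Defs
begin

text \<open>
  Since all block row and column sums of \<open>L\<close> vanish and \<open>L\<close> is block symmetric, the block sum
  of \<open>L \<box>\<times> R\<close> is \<open>-2\<close> times the block trace of \<open>L C\<close>, where \<open>C\<close> is the (1)-inverse defining \<open>R\<close>.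
  Put \<open>Q = I - L C\<close>. From \<open>Q L = 0\<close> and connectedness, the block \<open>Q\<^sub>i\<^sub>j\<close> does not depend on \<open>j\<close>,
  so the block trace of \<open>Q\<close> equals the sum of any of its block columns. The latter is the
  identity, as the block columns of \<open>L C\<close> sum to zero.
\<close>

lemma matrix_mult_add_left:
  fixes A B :: "real^'m^'l" and C :: "real^'p^'m"
  shows "(A + B) ** C = A ** C + B ** C"
  by (simp add: matrix_matrix_mult_def vec_eq_iff distrib_right sum.distrib)

lemma matrix_mult_sum_left:
  fixes A :: "'i \<Rightarrow> real^'m^'l" and B :: "real^'p^'m"
  shows "(\<Sum>i\<in>S. A i) ** B = (\<Sum>i\<in>S. A i ** B)"
  by (induction S rule: infinite_finite_induct) (simp_all add: matrix_mult_add_left)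

lemma matrix_mult_sum_right:
  fixes A :: "real^'m^'l" and B :: "'i \<Rightarrow> real^'p^'m"
  shows "A ** (\<Sum>i\<in>S. B i) = (\<Sum>i\<in>S. A ** B i)"
  by (induction S rule: infinite_finite_induct) (simp_all add: matrix_add_ldistrib)

lemma matrix_mult_diff_left:
  fixes A B :: "real^'m^'l" and C :: "real^'p^'m"
  shows "(A - B) ** C = A ** C - B ** C"
  by (simp add: matrix_matrix_mult_def vec_eq_iff left_diff_distrib sum_subtractf)

lemma matrix_mult_diff_right:
  fixes A :: "real^'m^'l" and B C :: "real^'p^'m"
  shows "A ** (B - C) = A ** B - A ** C"
  by (simp add: matrix_matrix_mult_def vec_eq_iff right_diff_distrib sum_subtractf)

lemma block_matrix_mult:
  "block (M ** N) i j = (\<Sum>l\<in>UNIV. block M i l ** block N l j)"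
  by (simp add: vec_eq_iff block_def matrix_matrix_mult_def sum.cartesian_product flip: UNIV_Times_UNIV)

lemma block_diff: "block (M - N) i j = block M i j - block N i j"
  by (simp add: vec_eq_iff block_def)

lemma block_zero: "block 0 i j = 0"
  by (simp add: vec_eq_iff block_def)

lemma block_mat: "block (mat c) i j = (if i = j then mat c else 0)"
  by (simp add: vec_eq_iff block_def mat_def)

lemma invertible_pos_def:
  assumes "pos_def A"
  shows "invertible A"
proof -
  have "x = 0" if "A *v x = 0" for x
    using assms that unfolding pos_def_def by force
  then show ?thesis
    by (simp add: invertible_left_inverse matrix_left_invertible_ker)
qed

lemma invertible_matrix_inv_right:
  "invertible A \<Longrightarrow> A ** matrix_inv A = mat 1"
  unfolding invertible_def matrix_inv_def by (rule someI2_ex) auto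

text \<open>Substituting \<open>x = A *v z\<close> turns the quadratic form of the inverse at
  \<open>x\<close> into that of \<open>A\<close> at \<open>z\<close>.\<close>

lemma pos_def_matrix_inv:
  fixes A :: "real^'k::finite^'k"
  assumes "pos_def A" and "x \<noteq> 0"
  shows "0 < x \<bullet> (matrix_inv A *v x)"
proof -
  define z where "z = matrix_inv A *v x"
  have x: "A *v z = x"
    using invertible_matrix_inv_right[OF invertible_pos_def[OF assms(1)]]
    by (simp add: z_def matrix_vector_mul_assoc)
  then have "z \<noteq> 0"
    using assms(2) by auto
  then have "0 < z \<bullet> (A *v z)"
    using assms(1) by (simp add: pos_def_def)
  then show ?thesis
    using x by (simp add: z_def inner_commute)
qed

text \<open>Inverse weights extended by zero to non-adjacent pairs, so that sums over neighbours
  become sums over all vertices.\<close>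

definition conductance ::
  "('n \<Rightarrow> 'n \<Rightarrow> bool) \<Rightarrow> ('n \<Rightarrow> 'n \<Rightarrow> real^'k^'k) \<Rightarrow> 'n \<Rightarrow> 'n \<Rightarrow> real^'k^'k" where
  "conductance E W i j = (if E i j then matrix_inv (W i j) else 0)"

lemma conductance_commute:
  "matrix_weighted_graph E W \<Longrightarrow> conductance E W i j = conductance E W j i"
  unfolding matrix_weighted_graph_def conductance_def by (metis sympD)

text \<open>The graph has no loops, so the subtracted conductance vanishes on the diagonal and one
  formula covers all blocks.\<close>

lemma block_laplacian:
  assumes "matrix_weighted_graph E W"
  shows "block (laplacian E W) i j =
    (if i = j then \<Sum>l\<in>UNIV. conductance E W i l else 0) - conductance E W i j"
proof -
  have "\<not> E i i"
    using assms by (auto simp: matrix_weighted_graph_def irreflp_def)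
  then show ?thesis
    by (auto simp: laplacian_def conductance_def sum.If_cases)
qed

lemma block_laplacian_commute:
  "matrix_weighted_graph E W \<Longrightarrow> block (laplacian E W) i j = block (laplacian E W) j i"
  by (auto simp: block_laplacian conductance_commute)

lemma laplacian_block_row_sum:
  "matrix_weighted_graph E W \<Longrightarrow> (\<Sum>j\<in>UNIV. block (laplacian E W) i j) = 0"
  by (simp add: block_laplacian sum_subtractf)

lemma laplacian_block_column_sum:
  "matrix_weighted_graph E W \<Longrightarrow> (\<Sum>i\<in>UNIV. block (laplacian E W) i j) = 0"
  using laplacian_block_row_sum[of E W j] block_laplacian_commute[of E W _ j] by simp

text \<open>A Dirichlet energy argument: harmonicity makes the total energy zero. Its terms are
  nonnegative, and positive on edges where \<open>y\<close> changes, so \<open>y\<close> is constant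
  along edges and hence along paths.\<close>

lemma harmonic_imp_constant:
  fixes y :: "'n::finite \<Rightarrow> real^'k::finite"
  assumes G: "matrix_weighted_graph E W"
    and harmonic: "\<And>j. (\<Sum>l\<in>UNIV. (y j - y l) v* conductance E W j l) = 0"
  shows "y i = y j"
proof -
  let ?A = "conductance E W"
  let ?e = "\<lambda>j l. (y j - y l) \<bullet> (?A j l *v (y j - y l))"
  have pos: "0 < ?e j l" if "E j l" "y j \<noteq> y l" for j l
    using G that pos_def_matrix_inv[of "W j l" "y j - y l"]
    by (simp add: matrix_weighted_graph_def conductance_def)
  have nonneg: "0 \<le> ?e j l" for j l
    using pos[of j l] by (cases "E j l"; cases "y j = y l") (auto simp: conductance_def)
  \<comment> \<open>Half of the energy: the harmonic equation at \<open>j\<close> paired with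
    \<open>y j\<close>.\<close>
  have zero: "(\<Sum>j\<in>UNIV. \<Sum>l\<in>UNIV. (y j - y l) \<bullet> (?A j l *v y j)) = 0"
  proof -
    have "(\<Sum>l\<in>UNIV. (y j - y l) \<bullet> (?A j l *v y j))
        = (\<Sum>l\<in>UNIV. (y j - y l) v* ?A j l) \<bullet> y j" for j
      by (simp only: inner_sum_left dot_lmul_matrix)
    then show ?thesis
      by (simp only: harmonic inner_zero_left sum.neutral_const)
  qed
  \<comment> \<open>The other half reduces to the first by exchanging the endpoints \<open>j\<close>
    and \<open>l\<close>, as conductances are symmetric.\<close>
  have "(\<Sum>j\<in>UNIV. \<Sum>l\<in>UNIV. (y j - y l) \<bullet> (?A j l *v y l))
      = (\<Sum>j\<in>UNIV. \<Sum>l\<in>UNIV. (y l - y j) \<bullet> (?A l j *v y j))"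
    by (rule sum.swap)
  also have "\<dots> = - (\<Sum>j\<in>UNIV. \<Sum>l\<in>UNIV. (y j - y l) \<bullet> (?A j l *v y j))"
    by (simp add: conductance_commute[OF G, of _ "_"] inner_diff_left flip: sum_negf)
  finally have "(\<Sum>j\<in>UNIV. \<Sum>l\<in>UNIV. ?e j l) = 0"
    using zero by (simp add: matrix_vector_mult_diff_distrib inner_diff_right sum_subtractf)
  then have "?e j l = 0" for j l
    by (simp add: sum_nonneg_eq_0_iff sum_nonneg nonneg)
  then have step: "y j = y l" if "E j l" for j l
    using pos[OF that] by force
  have "E\<^sup>*\<^sup>* i j"
    using G by (simp add: matrix_weighted_graph_def)
  then show ?thesis
    by (induction rule: rtranclp_induct) (auto dest: step)
qed

lemma row_vector_matrix_mult:
  fixes A :: "real^'m^'l" and B :: "real^'p^'m"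
  shows "(A ** B) $ a = (A $ a) v* B"
  by (simp add: vec_eq_iff matrix_matrix_mult_def vector_matrix_mult_def mult.commute)

text \<open>For fixed \<open>i\<close> and \<open>a\<close>, the row vectors
  \<open>block Q i j $ a\<close>, viewed as a function of the vertex \<open>j\<close>, are
  harmonic.\<close>

lemma left_annihilator_laplacian:
  assumes G: "matrix_weighted_graph E W" and Q: "Q ** laplacian E W = 0"
  shows "block Q i j = block Q i l"
proof -
  let ?A = "conductance E W"
  have "(\<Sum>l\<in>UNIV. (block Q i j - block Q i l) ** ?A j l) = 0" for j
  proof -
    have "0 = block (Q ** laplacian E W) i j"
      by (simp add: Q block_zero)
    also have "\<dots> = (\<Sum>l\<in>UNIV. (if l = j then block Q i j ** (\<Sum>m\<in>UNIV. ?A j m) else 0)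
        - block Q i l ** ?A j l)"
      unfolding block_matrix_mult block_laplacian[OF G]
      by (intro sum.cong) (auto simp: matrix_mult_diff_right conductance_commute[OF G, of _ j])
    \<comment> \<open>The diagonal block supplies one copy of \<open>block Q i j ** ?A j l\<close>
      for each \<open>l\<close>, which pairs with the off-diagonal term.\<close>
    also have "\<dots> = (\<Sum>l\<in>UNIV. (block Q i j - block Q i l) ** ?A j l)"
      by (simp add: sum_subtractf matrix_mult_diff_left matrix_mult_sum_right)
    finally show ?thesis ..
  qed
  then have "(\<Sum>l\<in>UNIV. (block Q i j - block Q i l) ** ?A j l) $ a = 0" for j a
    by simp
  then have "(\<Sum>l\<in>UNIV. (block Q i j $ a - block Q i l $ a) v* ?A j l) = 0" for j a
    by (simp only: sum_component row_vector_matrix_mult vector_minus_component)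
  then have "block Q i j $ a = block Q i l $ a" for a
    using harmonic_imp_constant[OF G, of "\<lambda>j. block Q i j $ a"] by blast
  then show ?thesis
    by (simp add: vec_eq_iff)
qed

lemma block_trace_laplacian_mult_one_inverse:
  fixes E :: "'n::finite \<Rightarrow> 'n \<Rightarrow> bool" and W :: "'n \<Rightarrow> 'n \<Rightarrow> real^'k::finite^'k"
  assumes G: "matrix_weighted_graph E W" and C: "one_inverse (laplacian E W) C"
  shows "(\<Sum>i\<in>UNIV. block (laplacian E W ** C) i i) = (real CARD('n) - 1) *\<^sub>R mat 1"
proof -
  let ?L = "laplacian E W"
  let ?Q = "mat 1 - ?L ** C"
  \<comment> \<open>Any block column will do as the reference column.\<close>
  fix j :: 'n
  have "?Q ** ?L = 0"
    using C by (simp add: one_inverse_def matrix_mult_diff_left)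
  then have "(\<Sum>i\<in>UNIV. block ?Q i i) = (\<Sum>i\<in>UNIV. block ?Q i j)"
    by (intro sum.cong left_annihilator_laplacian[OF G]) auto
  also have "\<dots> = mat 1 - (\<Sum>i\<in>UNIV. \<Sum>l\<in>UNIV. block ?L i l ** block C l j)"
    by (simp add: block_diff block_mat block_matrix_mult sum_subtractf)
  also have "(\<Sum>i\<in>UNIV. \<Sum>l\<in>UNIV. block ?L i l ** block C l j)
      = (\<Sum>l\<in>UNIV. (\<Sum>i\<in>UNIV. block ?L i l) ** block C l j)"
    by (subst sum.swap) (simp add: matrix_mult_sum_left)
  finally have "(\<Sum>i\<in>UNIV. block ?Q i i) = mat 1"
    by (simp add: laplacian_block_column_sum[OF G])
  \<comment> \<open>The block trace of the identity is \<open>CARD('n)\<close> copies of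
    \<open>mat 1\<close>, and that of \<open>?Q\<close> removes one.\<close>
  then show ?thesis
    by (simp add: block_diff block_mat sum_subtractf sum_constant_scaleR algebra_simps
        del: sum_constant)
qed

theorem theorem3p5:
  fixes E :: "'n::finite \<Rightarrow> 'n \<Rightarrow> bool"
    and W :: "'n \<Rightarrow> 'n \<Rightarrow> real^'k^'k"
    and R :: "('n, 'k::finite) block_matrix"
  assumes "matrix_weighted_graph E W"
    and "resistance_matrix E W R"
  shows "block_sum (laplacian E W \<box>\<times> R) = (- 2 * (real CARD('n) - 1)) *\<^sub>R mat 1"
proof -
  note G = assms(1)
  obtain C where C: "one_inverse (laplacian E W) C"
    and R: "R = of_blocks (\<lambda>i j. block C i i + block C j j - block C i j - block C j i)"
    using assms(2) by (auto simp: resistance_matrix_def)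
  let ?L = "block (laplacian E W)"
  let ?T = "\<Sum>i\<in>UNIV. block (laplacian E W ** C) i i"
  \<comment> \<open>The factor \<open>block C i i\<close> is free of \<open>j\<close>, so a block
    row sum of the Laplacian splits off; \<open>columns\<close> is the dual case.\<close>
  have rows: "(\<Sum>i\<in>UNIV. \<Sum>j\<in>UNIV. ?L i j ** block C i i) = 0"
    by (simp add: laplacian_block_row_sum[OF G] flip: matrix_mult_sum_left)
  have columns: "(\<Sum>i\<in>UNIV. \<Sum>j\<in>UNIV. ?L i j ** block C j j) = 0"
    by (subst sum.swap) (simp add: laplacian_block_column_sum[OF G] flip: matrix_mult_sum_left)
  have trace: "(\<Sum>i\<in>UNIV. \<Sum>j\<in>UNIV. ?L i j ** block C j i) = ?T"
    by (simp add: block_matrix_mult)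
  \<comment> \<open>\<open>C\<close> need not be symmetric; the block symmetry of the Laplacian is
    what allows the indices to be exchanged.\<close>
  have "(\<Sum>i\<in>UNIV. \<Sum>j\<in>UNIV. ?L i j ** block C i j)
      = (\<Sum>j\<in>UNIV. \<Sum>i\<in>UNIV. ?L j i ** block C i j)"
    by (subst sum.swap) (simp only: block_laplacian_commute[OF G])
  then have trace': "(\<Sum>i\<in>UNIV. \<Sum>j\<in>UNIV. ?L i j ** block C i j) = ?T"
    using trace by simp
  have "block_sum (laplacian E W \<box>\<times> R) = - ?T - ?T"
    by (simp add: block_sum_def boxtimes_def R matrix_mult_diff_right matrix_add_ldistrib
        sum_subtractf sum.distrib rows columns trace trace')
  also have "\<dots> = (- 2 * (real CARD('n) - 1)) *\<^sub>R mat 1"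
    unfolding block_trace_laplacian_mult_one_inverse[OF G C]
    by (simp flip: scaleR_left.minus scaleR_left.diff)
  finally show ?thesis .
qed

end
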